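(* Let $a,b$ and $M$ be integers satisfying $1\le a<b<\frac{M}{2}$ and $\gcd(b,M)=1$. For an integer $L\geq 0$, define $c(m,n)$ (depending on $L$) by $$\frac{1}{(zq^a,zq^{M-a};q^M)_{L}\,(1-zq^{LM+a})} - \frac{1}{(zq^b,zq^{M-b};q^M)_{L}} =: \sum_{m,n\geq 0} c(m,n)z^mq^n.$$ Then for all integers $L,m,n\geq 0$ we have $c(m,nM)\geq 0$. If in addition $M$ is even and $a$ is odd, then also $c\left(m,nM+\frac{M}{2}\right)\geq 0$ for all integers $L,m,n\geq 0$.
   Context: Notation: $(x;q)_n := \prod_{j=0}^{n-1}(1-xq^j)$ and $(x_1,\dots,x_r;q)_n := (x_1;q)_n\cdots(x_r;q)_n$, with empty products equal to $1$; thus $(zq^s,zq^t;q^M)_L=\prod_{j=0}^{L-1}(1-zq^{Mj+s})(1-zq^{Mj+t})$. Quotients are expanded as formal power series in $z$ and $q$. *)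

theory Defs
  imports "HOL-Computational_Algebra.Formal_Power_Series"
begin

definition qpoch :: "'a::comm_ring_1 \<Rightarrow> 'a \<Rightarrow> nat \<Rightarrow> 'a" where
  "qpoch x q n = (\<Prod>j<n. 1 - x * q ^ j)"

definition qpochs :: "'a::comm_ring_1 list \<Rightarrow> 'a \<Rightarrow> nat \<Rightarrow> 'a" where
  "qpochs xs q n = (\<Prod>x\<leftarrow>xs. qpoch x q n)"

text \<open>
  Formal power series in \<open>z\<close> and \<open>q\<close> are power series in \<open>z\<close> whose coefficients are power
  series in \<open>q\<close>. The scalars are rational so that the library's inverse and division of formal
  power series are available.
\<close>

definition zvar :: "rat fps fps" where
  "zvar = fps_X"

definition qvar :: "rat fps fps" where
  "qvar = fps_const fps_X"

text \<open>The subtraction in \<open>M - a\<close> is exact whenever \<open>a \<le> M\<close>.\<close>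

definition cden1 :: "nat \<Rightarrow> nat \<Rightarrow> nat \<Rightarrow> rat fps fps" where
  "cden1 a M L =
     qpochs [zvar * qvar ^ a, zvar * qvar ^ (M - a)] (qvar ^ M) L * (1 - zvar * qvar ^ (L * M + a))"

definition cden2 :: "nat \<Rightarrow> nat \<Rightarrow> nat \<Rightarrow> rat fps fps" where
  "cden2 b M L = qpochs [zvar * qvar ^ b, zvar * qvar ^ (M - b)] (qvar ^ M) L"

definition cseries :: "nat \<Rightarrow> nat \<Rightarrow> nat \<Rightarrow> nat \<Rightarrow> rat fps fps" where
  "cseries a b M L = 1 / cden1 a M L - 1 / cden2 b M L"

text \<open>The coefficient of \<open>z\<^sup>m q\<^sup>n\<close>.\<close>

definition ccoeff :: "nat \<Rightarrow> nat \<Rightarrow> nat \<Rightarrow> nat \<Rightarrow> nat \<Rightarrow> nat \<Rightarrow> rat" where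
  "ccoeff a b M L m n = fps_nth (fps_nth (cseries a b M L) m) n"

text \<open>
  The scalar ring \<^typ>\<open>rat fps\<close> is not a field, so the division in \<^const>\<open>cseries\<close> is a genuine
  quotient only because the constant terms in \<open>z\<close> of the denominators are 1.
\<close>

lemma fps_one_divide_mult:
  fixes f :: "'a::field fps fps"
  assumes "fps_nth f 0 = 1"
  shows "1 / f * f = 1"
proof -
  have "subdegree f = 0"
    using assms by (simp add: subdegree_eq_0_iff)
  moreover have "inverse f * f = 1"
  proof -
    have inv: "inverse (fps_nth f 0) = 1"
      using assms by simp
    have "fps_right_inverse f (inverse (fps_nth f 0)) * f = 1"
      unfolding inv using assms by (intro fps_left_inverse'[of 1]) simp_all
    then show ?thesis
      by (simp only: fps_inverse_def)
  qed
  ultimately show ?thesis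
    by (simp add: fps_divide_def)
qed

lemma qpoch_zvar_nth_0 [simp]: "fps_nth (qpoch (zvar * u) v n) 0 = 1"
  by (induction n) (simp_all add: qpoch_def zvar_def)

lemma cden1_quotient: "1 / cden1 a M L * cden1 a M L = 1"
  by (rule fps_one_divide_mult) (simp add: cden1_def qpochs_def, simp add: zvar_def)

lemma cden2_quotient: "1 / cden2 b M L * cden2 b M L = 1"
  by (rule fps_one_divide_mult) (simp add: cden2_def qpochs_def)

end

theory Submission
  imports Defs "HOL-Number_Theory.Cong"
begin

text \<open>
  Put \<open>Q = q\<^sup>M\<close> and let \<open>H(n, i)\<close> be the coefficient of \<open>z\<^sup>i\<close> in
  \<open>1 / ((1 - z) (1 - z Q) \<cdots> (1 - z Q\<^sup>n\<^sup>-\<^sup>1))\<close>. The coefficient of \<open>z\<^sup>m\<close> in the difference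
  is the sum over \<open>i + j = m\<close> of
  \<open>q\<^bsup>ai + (M - a)j\<^esup> H(L + 1, i) H(L, j) - q\<^bsup>bi + (M - b)j\<^esup> H(L, i) H(L, j)\<close>. Add the terms of
  \<open>(i, j)\<close> and \<open>(j, i)\<close>, where \<open>h = i - j > 0\<close>. If the negative part contributes to the
  exponents considered, then \<open>(b - a) h = M d\<close> and \<open>(M - a - b) h = M e\<close> with
  \<open>d < e \<le> i\<close>. Up to a power of \<open>q\<close> the pair then equals
  \<open>H(L, j) (H(L + 1, i) + (Q\<^bsup>d + e\<^esup> - Q\<^sup>d - Q\<^sup>e) H(L, i)) + Q\<^bsup>d + e\<^esup> H(L, i) (H(L + 1, j) - H(L, j))\<close>,
  which is nonnegative.
\<close>

section \<open>Power series with nonnegative coefficients\<close>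

definition fps_nonneg :: "'a::linordered_idom fps \<Rightarrow> bool" where
  "fps_nonneg f \<longleftrightarrow> (\<forall>n. 0 \<le> fps_nth f n)"

lemma fps_nonneg_0 [simp]: "fps_nonneg 0"
  and fps_nonneg_1 [simp]: "fps_nonneg 1"
  and fps_nonneg_X [simp]: "fps_nonneg fps_X"
  by (simp_all add: fps_nonneg_def fps_X_def)

lemma fps_nonneg_add: "fps_nonneg f \<Longrightarrow> fps_nonneg g \<Longrightarrow> fps_nonneg (f + g)"
  by (simp add: fps_nonneg_def)

lemma fps_nonneg_mult: "fps_nonneg f \<Longrightarrow> fps_nonneg g \<Longrightarrow> fps_nonneg (f * g)"
  by (simp add: fps_nonneg_def fps_mult_nth sum_nonneg)

lemma fps_nonneg_power: "fps_nonneg f \<Longrightarrow> fps_nonneg (f ^ n)"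
  by (induction n) (simp_all add: fps_nonneg_mult)

lemma fps_nonneg_sum: "(\<And>i. i \<in> A \<Longrightarrow> fps_nonneg (f i)) \<Longrightarrow> fps_nonneg (sum f A)"
  by (simp add: fps_nonneg_def fps_sum_nth sum_nonneg)

section \<open>Complete homogeneous polynomials in powers of \<open>q\<close>\<close>

definition fps_geom :: "'a::comm_ring_1 \<Rightarrow> 'a fps" where
  "fps_geom c = Abs_fps (\<lambda>n. c ^ n)"

lemma fps_geom_nth [simp]: "fps_nth (fps_geom c) n = c ^ n"
  by (simp add: fps_geom_def)

lemma fps_geom_mult: "fps_geom c * (1 - fps_X * fps_const c) = 1"
proof (rule fps_ext)
  fix n
  show "fps_nth (fps_geom c * (1 - fps_X * fps_const c)) n = fps_nth 1 n"
    by (cases n) (simp_all add: right_diff_distrib mult.assoc [symmetric] mult.commute[of _ fps_X])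
qed

text \<open>The exponents form an arbitrary set, so that single factors of the denominator can be
  cancelled.\<close>

definition complete_gf :: "'a::comm_ring_1 \<Rightarrow> nat set \<Rightarrow> 'a fps" where
  "complete_gf q S = (\<Prod>s\<in>S. fps_geom (q ^ s))"

lemma complete_gf_remove:
  assumes "finite S" "s \<in> S"
  shows "complete_gf q S * (1 - fps_X * fps_const (q ^ s)) = complete_gf q (S - {s})"
proof -
  have "complete_gf q S * (1 - fps_X * fps_const (q ^ s))
      = fps_geom (q ^ s) * (1 - fps_X * fps_const (q ^ s)) * complete_gf q (S - {s})"
    unfolding complete_gf_def prod.remove[OF assms] by (simp only: mult_ac)
  then show ?thesis by (simp add: fps_geom_mult)
qed

lemma nonneg_complete_gf:
  assumes "fps_nonneg q"
  shows "fps_nonneg (fps_nth (complete_gf q S) n)"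
proof (induction S arbitrary: n rule: infinite_finite_induct)
  case (insert s S)
  then show ?case
    by (auto simp: complete_gf_def fps_mult_nth intro!: fps_nonneg_sum fps_nonneg_mult
        fps_nonneg_power assms)
qed (auto simp: complete_gf_def)

lemma nth_prod_geom_scale:
  "fps_nth (\<Prod>s\<in>S. fps_geom (u * q ^ s)) n = u ^ n * fps_nth (complete_gf q S) n"
proof (induction S arbitrary: n rule: infinite_finite_induct)
  case (insert s S)
  have "fps_nth (\<Prod>s\<in>insert s S. fps_geom (u * q ^ s)) n
      = (\<Sum>i=0..n. (u * q ^ s) ^ i * (u ^ (n - i) * fps_nth (complete_gf q S) (n - i)))"
    using insert by (simp add: fps_mult_nth)
  also have "\<dots> = (\<Sum>i=0..n. u ^ n * ((q ^ s) ^ i * fps_nth (complete_gf q S) (n - i)))"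
  proof (rule sum.cong)
    fix i assume "i \<in> {0..n}"
    then have "u ^ n = u ^ i * u ^ (n - i)"
      by (simp add: power_add [symmetric])
    then show "(u * q ^ s) ^ i * (u ^ (n - i) * fps_nth (complete_gf q S) (n - i))
        = u ^ n * ((q ^ s) ^ i * fps_nth (complete_gf q S) (n - i))"
      by (simp add: power_mult_distrib mult_ac)
  qed simp
  also have "\<dots> = u ^ n * fps_nth (complete_gf q (insert s S)) n"
    using insert by (simp add: complete_gf_def fps_mult_nth sum_distrib_left)
  finally show ?case .
qed (auto simp: complete_gf_def)

text \<open>
  The complete homogeneous polynomial \<open>h\<^sub>i(1, q, \<dots>, q\<^sup>n\<^sup>-\<^sup>1)\<close>, that is, the Gaussian
  binomial coefficient with upper entry \<open>n + i - 1\<close> and lower entry \<open>i\<close>.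
\<close>

definition complete_hom :: "'a::comm_ring_1 \<Rightarrow> nat \<Rightarrow> nat \<Rightarrow> 'a" where
  "complete_hom q n i = fps_nth (complete_gf q {..<n}) i"

lemma complete_hom_0_left: "complete_hom q 0 i = (if i = 0 then 1 else 0)"
  by (simp add: complete_hom_def complete_gf_def)

lemma complete_hom_0_right [simp]: "complete_hom q n 0 = 1"
  by (induction n) (simp_all add: complete_hom_def complete_gf_def lessThan_Suc fps_mult_nth)

lemma complete_hom_1_left [simp]: "complete_hom q (Suc 0) i = 1"
  by (simp add: complete_hom_def complete_gf_def lessThan_Suc)

text \<open>Cancels the last factor of the denominator.\<close>

lemma complete_hom_Suc_left:
  "complete_hom q (Suc n) (Suc i) =
     complete_hom q n (Suc i) + q ^ n * complete_hom q (Suc n) i"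
proof -
  have "complete_gf q {..<Suc n} * (1 - fps_X * fps_const (q ^ n)) = complete_gf q {..<n}"
    by (subst complete_gf_remove) (auto intro!: arg_cong[where f = "complete_gf q"])
  then have "complete_gf q {..<Suc n}
      = complete_gf q {..<n} + fps_X * (fps_const (q ^ n) * complete_gf q {..<Suc n})"
    by (simp add: algebra_simps)
  from arg_cong[OF this, of "\<lambda>f. fps_nth f (Suc i)"] show ?thesis
    by (simp add: complete_hom_def)
qed

text \<open>Cancels the first factor instead; those that remain are the factors for \<open>n\<close>
  with the variable scaled by \<open>q\<close>.\<close>

lemma complete_hom_Suc_right:
  "complete_hom q (Suc n) (Suc i) =
     complete_hom q (Suc n) i + q ^ Suc i * complete_hom q n (Suc i)"
proof -
  have "complete_gf q {..<Suc n} = fps_geom 1 * (\<Prod>s<n. fps_geom (q * q ^ s))"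
    by (simp add: complete_gf_def prod.lessThan_Suc_shift del: prod.lessThan_Suc)
  then have "complete_gf q {..<Suc n} * (1 - fps_X)
      = fps_geom 1 * (1 - fps_X) * (\<Prod>s<n. fps_geom (q * q ^ s))"
    by (simp only: mult_ac)
  then have "complete_gf q {..<Suc n} * (1 - fps_X) = (\<Prod>s<n. fps_geom (q * q ^ s))"
    using fps_geom_mult[of "1::'a"] by simp
  then have "complete_gf q {..<Suc n}
      = fps_X * complete_gf q {..<Suc n} + (\<Prod>s<n. fps_geom (q * q ^ s))"
    by (simp add: algebra_simps)
  from arg_cong[OF this, of "\<lambda>f. fps_nth f (Suc i)"] show ?thesis
    by (simp add: complete_hom_def nth_prod_geom_scale)
qed

text \<open>The exchange of \<open>n\<close> and \<open>i\<close> turns one of the two recurrences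
  into the other.\<close>

lemma complete_hom_sym: "complete_hom q (Suc n) i = complete_hom q (Suc i) n"
proof (induction "n + i" arbitrary: n i rule: less_induct)
  case less
  show ?case
  proof (cases n)
    case (Suc k)
    show ?thesis
    proof (cases i)
      case (Suc l)
      have "complete_hom q (Suc k) (Suc l) = complete_hom q (Suc (Suc l)) k"
        and "complete_hom q (Suc (Suc k)) l = complete_hom q (Suc l) (Suc k)"
        using less[of k "Suc l"] less[of "Suc k" l] \<open>n = Suc k\<close> Suc by simp_all
      then show ?thesis
        using complete_hom_Suc_left[of q "Suc k" l] complete_hom_Suc_right[of q "Suc l" k] \<open>n = Suc k\<close> Suc
        by simp
    qed simp
  qed simp
qed

lemma nonneg_complete_hom: "fps_nonneg q \<Longrightarrow> fps_nonneg (complete_hom q n i)"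
  by (simp add: complete_hom_def nonneg_complete_gf)

lemma nonneg_complete_hom_Suc_diff:
  assumes "fps_nonneg q"
  shows "fps_nonneg (complete_hom q (Suc n) i - complete_hom q n i)"
  using assms
  by (cases i) (simp_all add: complete_hom_Suc_left fps_nonneg_mult fps_nonneg_power nonneg_complete_hom)

text \<open>
  By symmetry \<open>complete_hom q (n + 1) i\<close> and \<open>complete_hom q n i\<close> are the coefficients of \<open>y\<^sup>n\<close> and
  \<open>y\<^sup>n\<^sup>-\<^sup>1\<close> in \<open>F = 1 / ((1 - y) (1 - y q) \<cdots> (1 - y q\<^sup>i))\<close>, and
  \<open>1 - y q\<^sup>d - y q\<^sup>e + y q\<^sup>d\<^sup>+\<^sup>e = (1 - y q\<^sup>d) (1 - y q\<^sup>e) + y q\<^sup>d\<^sup>+\<^sup>e (1 - y)\<close>.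
  As \<open>d \<noteq> e\<close>, all the factors on the right cancel against factors of the denominator of \<open>F\<close>.
\<close>

lemma nonneg_complete_hom_key:
  assumes q: "fps_nonneg q" and "d \<le> i" "e \<le> i" "d \<noteq> e" "0 < i"
  shows "fps_nonneg (complete_hom q (Suc n) i + (q ^ (d + e) - q ^ d - q ^ e) * complete_hom q n i)"
proof (cases n)
  \<comment> \<open>There is no coefficient of index \<open>n - 1\<close> here, but
    \<open>complete_hom q 0 i\<close> vanishes because \<open>0 < i\<close>.\<close>
  case 0
  then show ?thesis using \<open>0 < i\<close> by (simp add: complete_hom_0_left)
next
  case (Suc k)
  define F where "F = complete_gf q {..<Suc i}"
  have F1: "F * (1 - fps_X * fps_const (q ^ d)) * (1 - fps_X * fps_const (q ^ e))
      = complete_gf q ({..<Suc i} - {d} - {e})"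
    unfolding F_def using assms by (subst complete_gf_remove) (auto intro!: complete_gf_remove)
  have F2: "F * (1 - fps_X) = complete_gf q ({..<Suc i} - {0})"
    using complete_gf_remove[of "{..<Suc i}" 0 q] by (simp add: F_def)
  have "F + fps_X * (fps_const (q ^ (d + e) - q ^ d - q ^ e) * F)
      = F * (1 - fps_X * fps_const (q ^ d)) * (1 - fps_X * fps_const (q ^ e))
        + fps_X * (fps_const (q ^ (d + e)) * (F * (1 - fps_X)))"
    by (simp add: algebra_simps power_add flip: fps_const_sub fps_const_mult fps_const_add)
  from arg_cong[OF this [unfolded F1 F2], of "\<lambda>f. fps_nth f (Suc k)"]
  have "complete_hom q (Suc n) i + (q ^ (d + e) - q ^ d - q ^ e) * complete_hom q n i
      = fps_nth (complete_gf q ({..<Suc i} - {d} - {e})) (Suc k)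
        + q ^ (d + e) * fps_nth (complete_gf q ({..<Suc i} - {0})) k"
    by (simp add: Suc complete_hom_sym[of q _ i] complete_hom_def [of q "Suc i"] F_def)
  then show ?thesis
    using q by (simp add: fps_nonneg_add fps_nonneg_mult fps_nonneg_power nonneg_complete_gf)
qed

text \<open>Only exponents divisible by \<open>M\<close> occur in \<open>fps_X ^ M\<close>; products
  and the recurrence preserve this.\<close>

lemma nth_complete_hom_power_eq_0:
  assumes "\<not> M dvd k"
  shows "fps_nth (complete_hom (fps_X ^ M) n i * complete_hom (fps_X ^ M) n' j) k = (0::'a::comm_ring_1)"
proof -
  define supp where "supp f \<longleftrightarrow> (\<forall>k. \<not> M dvd k \<longrightarrow> fps_nth f k = 0)" for f :: "'a fps"
  have mult: "supp (f * g)" if "supp f" "supp g" for f g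
    unfolding supp_def
  proof (intro allI impI)
    fix k assume k: "\<not> M dvd k"
    have "fps_nth f l * fps_nth g (k - l) = 0" if "l \<in> {0..k}" for l
    proof -
      have "\<not> M dvd l \<or> \<not> M dvd (k - l)"
        using k that dvd_add[of M l "k - l"] by auto
      then show ?thesis using \<open>supp f\<close> \<open>supp g\<close> by (auto simp: supp_def)
    qed
    then show "fps_nth (f * g) k = 0"
      by (simp add: fps_mult_nth)
  qed
  have one: "supp 1" by (auto simp: supp_def)
  have X: "supp (fps_X ^ M)" by (auto simp: supp_def fps_X_power_iff)
  have power: "supp (f ^ n)" if "supp f" for f n
    by (induction n) (auto simp: one mult that)
  have "supp (complete_hom (fps_X ^ M) n i)" for n i
  proof (induction n arbitrary: i)
    case 0
    then show ?case by (simp add: complete_hom_0_left supp_def)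
  next
    case (Suc n)
    show ?case
    proof (induction i)
      case (Suc i)
      have "supp ((fps_X ^ M) ^ n * complete_hom (fps_X ^ M) (Suc n) i)"
        by (intro mult power X Suc)
      with \<open>supp (complete_hom (fps_X ^ M) n (Suc i))\<close> show ?case
        by (simp add: complete_hom_Suc_left supp_def)
    qed (simp add: one)
  qed
  with mult assms show ?thesis by (simp add: supp_def)
qed

section \<open>Expansion of the two quotients in z\<close>

lemma one_divide_eqI:
  fixes f g :: "'a::field fps fps"
  assumes "g * f = 1" "fps_nth f 0 = 1"
  shows "1 / f = g"
proof -
  have "1 / f = 1 / f * (g * f)" by (simp add: assms)
  also have "\<dots> = (1 / f * f) * g" by (simp add: mult_ac)
  finally show ?thesis using fps_one_divide_mult[OF assms(2)] by simp
qed

lemma qpoch_inverse: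
  "(\<Prod>s<n. fps_geom (fps_X ^ c * (fps_X ^ M) ^ s)) * qpoch (zvar * qvar ^ c) (qvar ^ M) n = 1"
  by (simp add: qpoch_def zvar_def qvar_def prod.distrib [symmetric] fps_const_power mult.assoc
      fps_geom_mult)

text \<open>The contribution to the coefficient of z^(i+j) that takes z^i from the \<open>n\<close>
  factors starting at z q^c and z^j from the \<open>n'\<close> factors starting at z
  q^(M-c).\<close>

definition pair_term :: "nat \<Rightarrow> nat \<Rightarrow> nat \<Rightarrow> nat \<Rightarrow> nat \<Rightarrow> nat \<Rightarrow> rat fps" where
  "pair_term c M n n' i j =
     fps_X ^ (c * i + (M - c) * j) * (complete_hom (fps_X ^ M) n i * complete_hom (fps_X ^ M) n' j)"

lemma nth_prod_prod_geom:
  "fps_nth ((\<Prod>s<n. fps_geom (fps_X ^ c * (fps_X ^ M) ^ s)) *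
            (\<Prod>s<n'. fps_geom (fps_X ^ (M - c) * (fps_X ^ M) ^ s))) m
   = (\<Sum>i=0..m. pair_term c M n n' i (m - i))"
  unfolding fps_mult_nth nth_prod_geom_scale complete_hom_def [symmetric] pair_term_def power_add power_mult
  by (simp only: mult_ac)

lemma cseries_nth:
  "fps_nth (cseries a b M L) m =
    (\<Sum>i=0..m. pair_term a M (Suc L) L i (m - i) - pair_term b M L L i (m - i))"
proof -
  define D where "D c n = (\<Prod>s<n. fps_geom (fps_X ^ c * (fps_X ^ M) ^ s) :: rat fps fps)" for c n
  have D: "D c n * qpoch (zvar * qvar ^ c) (qvar ^ M) n = 1" for c n
    by (simp add: D_def qpoch_inverse)
  have den1: "cden1 a M L = qpoch (zvar * qvar ^ a) (qvar ^ M) (Suc L)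
      * qpoch (zvar * qvar ^ (M - a)) (qvar ^ M) L"
    by (simp add: cden1_def qpochs_def qpoch_def power_add power_mult [symmetric] mult_ac)
  have "1 / cden1 a M L = D a (Suc L) * D (M - a) L"
  proof (rule one_divide_eqI)
    show "D a (Suc L) * D (M - a) L * cden1 a M L = 1"
      using D[of a "Suc L"] D[of "M - a" L] unfolding den1
      by (metis (no_types, lifting) mult.assoc mult.left_commute mult_1_right)
  qed (simp add: den1)
  moreover have "1 / cden2 b M L = D b L * D (M - b) L"
  proof (rule one_divide_eqI)
    show "D b L * D (M - b) L * cden2 b M L = 1"
      using D[of b L] D[of "M - b" L] unfolding cden2_def qpochs_def
      by simp (metis (no_types, lifting) mult.assoc mult.left_commute mult_1_right)
  qed (simp add: cden2_def qpochs_def)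
  ultimately show ?thesis
    by (simp add: cseries_def D_def nth_prod_prod_geom sum_subtractf del: prod.lessThan_Suc)
qed

section \<open>Nonnegativity of symmetric pairs of terms\<close>

lemma nonneg_pair_term: "fps_nonneg (pair_term c M n n' i j)"
  unfolding pair_term_def
  by (intro fps_nonneg_mult nonneg_complete_hom fps_nonneg_power fps_nonneg_X)

text \<open>For \<open>i = j\<close> the prefactor is \<open>fps_X ^ (M * i)\<close> for both
  \<open>a\<close> and \<open>b\<close>.\<close>

lemma nonneg_pair_term_diag:
  assumes "a \<le> M" "b \<le> M"
  shows "fps_nonneg (pair_term a M (Suc L) L i i - pair_term b M L L i i)"
proof -
  have e: "c * i + (M - c) * i = M * i" if "c \<le> M" for c
    using that by (simp add: add_mult_distrib [symmetric])
  have "pair_term a M (Suc L) L i i - pair_term b M L L i i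
      = fps_X ^ (M * i) * (complete_hom (fps_X ^ M) L i
          * (complete_hom (fps_X ^ M) (Suc L) i - complete_hom (fps_X ^ M) L i))"
    using assms by (simp add: pair_term_def e algebra_simps)
  then show ?thesis
    by (simp add: fps_nonneg_mult fps_nonneg_power nonneg_complete_hom nonneg_complete_hom_Suc_diff)
qed

lemma nonneg_pair_term_symm:
  assumes "a < b" "2 * b < M" "j < i" "M dvd (b - a) * (i - j)" "M dvd (a + b) * (i - j)"
  shows "fps_nonneg (pair_term a M (Suc L) L i j + pair_term a M (Suc L) L j i
           - pair_term b M L L i j - pair_term b M L L j i)"
proof -
  define h where "h = i - j"
  have i: "i = j + h" and h: "0 < h" using assms by (auto simp: h_def)
  obtain d where d: "(b - a) * h = M * d" using assms by (auto simp: h_def)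
  have "(M - (a + b)) * h = M * h - (a + b) * h" by (simp add: diff_mult_distrib)
  then have "M dvd (M - (a + b)) * h" using assms by (simp add: h_def dvd_diff_nat)
  then obtain e where e: "(M - (a + b)) * h = M * e" by auto
  \<comment> \<open>Here \<open>2 * b < M\<close> enters: it says that
    \<open>b - a < M - (a + b)\<close>.\<close>
  have "M * d < M * e"
    using h assms unfolding d [symmetric] e [symmetric] by (intro mult_strict_right_mono) auto
  then have "d < e" by simp
  have "M * e \<le> M * h" unfolding e [symmetric] by (intro mult_right_mono) auto
  then have "e \<le> i" using assms i by simp
  \<comment> \<open>The least of the four exponents; the others exceed it by \<open>M * d\<close>,
    \<open>M * e\<close> and \<open>M * (d + e)\<close>. They are computed over the integers to
    avoid truncated subtraction.\<close>
  define E where "E = a * h + M * j"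
  have zd: "(int b - int a) * int h = int M * int d"
    using arg_cong[OF d, of int] assms by (simp add: of_nat_diff)
  have ze: "(int M - int a - int b) * int h = int M * int e"
    using arg_cong[OF e, of int] assms by (simp add: of_nat_diff diff_diff_eq)
  have M: "int (M - a) = int M - int a" "int (M - b) = int M - int b"
    using assms by auto
  have "a * i + (M - a) * j = E"
    by (rule of_nat_eq_iff [where 'a = int, THEN iffD1])
       (simp only: of_nat_add of_nat_mult M E_def i, simp add: algebra_simps)
  moreover have "b * i + (M - b) * j = E + M * d"
    by (rule of_nat_eq_iff [where 'a = int, THEN iffD1])
       (simp only: of_nat_add of_nat_mult M E_def i,
        use zd in \<open>simp add: algebra_simps\<close>)
  moreover have "b * j + (M - b) * i = E + M * e"
    by (rule of_nat_eq_iff [where 'a = int, THEN iffD1])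
       (simp only: of_nat_add of_nat_mult M E_def i,
        use ze in \<open>simp add: algebra_simps\<close>)
  moreover have "a * j + (M - a) * i = E + M * (d + e)"
    by (rule of_nat_eq_iff [where 'a = int, THEN iffD1])
       (simp only: of_nat_add of_nat_mult M E_def i,
        use zd ze in \<open>simp add: algebra_simps\<close>)
  ultimately have "pair_term a M (Suc L) L i j + pair_term a M (Suc L) L j i
      - pair_term b M L L i j - pair_term b M L L j i
    = fps_X ^ E * (complete_hom (fps_X ^ M) L j * (complete_hom (fps_X ^ M) (Suc L) i
          + ((fps_X ^ M) ^ (d + e) - (fps_X ^ M) ^ d - (fps_X ^ M) ^ e) * complete_hom (fps_X ^ M) L i)
        + (fps_X ^ M) ^ (d + e) * (complete_hom (fps_X ^ M) L i
          * (complete_hom (fps_X ^ M) (Suc L) j - complete_hom (fps_X ^ M) L j)))"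
    by (simp add: pair_term_def power_add power_mult algebra_simps)
  moreover have "fps_nonneg (complete_hom (fps_X ^ M) (Suc L) i
      + ((fps_X ^ M) ^ (d + e) - (fps_X ^ M) ^ d - (fps_X ^ M) ^ e) * complete_hom (fps_X ^ M) L i
      :: rat fps)"
    using \<open>d < e\<close> \<open>e \<le> i\<close> by (intro nonneg_complete_hom_key) (auto intro: fps_nonneg_power)
  ultimately show ?thesis
    by (simp add: fps_nonneg_add fps_nonneg_mult fps_nonneg_power nonneg_complete_hom
        nonneg_complete_hom_Suc_diff)
qed

section \<open>Residues of exponents modulo \<open>M\<close> and the conclusion\<close>

lemma pair_term_nth_eq_0:
  assumes "\<not> [c * i + (M - c) * j = N] (mod M)"
  shows "fps_nth (pair_term c M n n' i j) N = 0"
proof -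
  let ?e = "c * i + (M - c) * j"
  have "\<not> M dvd (N - ?e)" if "?e \<le> N"
    using assms that by (auto simp: cong_altdef_nat cong_sym_eq)
  then show ?thesis
    unfolding pair_term_def fps_X_power_mult_nth by (auto simp: nth_complete_hom_power_eq_0)
qed

text \<open>With \<open>h = i - j\<close>, the negative terms of a pair live in the residue classes
  of \<open>b * h\<close> and \<open>(M - b) * h\<close>. By \<open>res\<close>, if one of these is
  the class of \<open>N\<close>, then \<open>nonneg_pair_term_symm\<close> applies.\<close>

lemma ccoeff_nonneg:
  assumes ab: "a < b" "2 * b < M"
    and res: "\<And>h. [b * h = N] (mod M) \<or> [(M - b) * h = N] (mod M)
      \<Longrightarrow> M dvd (b - a) * h \<and> M dvd (a + b) * h"
  shows "0 \<le> ccoeff a b M L m N"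
proof -
  define T where "T i j = fps_nth (pair_term a M (Suc L) L i j - pair_term b M L L i j) N" for i j
  have less: "0 \<le> T i j + T j i" if "j < i" for i j
  proof (cases "M dvd (b - a) * (i - j) \<and> M dvd (a + b) * (i - j)")
    case True
    then show ?thesis
      using nonneg_pair_term_symm[of a b M j i L] ab that
      by (simp add: T_def fps_nonneg_def algebra_simps)
  next
    \<comment> \<open>Neither negative term reaches the exponent \<open>N\<close>, so only
      nonnegative ones remain.\<close>
    case False
    define h where "h = i - j"
    have i: "i = j + h" using that by (simp add: h_def)
    have M: "b * j + (M - b) * j = M * j" using ab by (simp add: add_mult_distrib [symmetric])
    have e1: "b * i + (M - b) * j = b * h + M * j"
      using M by (simp add: i algebra_simps)
    have e2: "b * j + (M - b) * i = (M - b) * h + M * j"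
      using M by (simp add: i add_mult_distrib2)
    have "\<not> [b * i + (M - b) * j = N] (mod M)" "\<not> [b * j + (M - b) * i = N] (mod M)"
      using False res[of h] unfolding e1 e2 by (auto simp: cong_def h_def)
    then have "fps_nth (pair_term b M L L i j) N = 0" "fps_nth (pair_term b M L L j i) N = 0"
      by (simp_all add: pair_term_nth_eq_0)
    then show ?thesis
      using nonneg_pair_term[of a M] by (simp add: T_def fps_nonneg_def)
  qed
  have symm: "0 \<le> T i j + T j i" for i j
  proof (cases i j rule: linorder_cases)
    case equal
    then show ?thesis
      using nonneg_pair_term_diag[of a M b L i] ab by (simp add: T_def fps_nonneg_def)
  qed (use less[of i j] less[of j i] in \<open>auto simp: add.commute\<close>)
  \<comment> \<open>Adding the reversed sum pairs each term with its mirror image and doubles the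
    total.\<close>
  have "(\<Sum>i=0..m. T i (m - i)) = (\<Sum>i=0..m. T (m - i) i)"
    by (rule sum.reindex_bij_witness[of _ "\<lambda>i. m - i" "\<lambda>i. m - i"]) auto
  then have "2 * (\<Sum>i=0..m. T i (m - i)) = (\<Sum>i=0..m. T i (m - i) + T (m - i) i)"
    by (simp add: sum.distrib)
  also have "\<dots> \<ge> 0" by (intro sum_nonneg symm)
  finally show ?thesis
    by (simp add: ccoeff_def cseries_nth T_def fps_sum_nth)
qed

theorem theorem1p2:
  fixes a b M :: nat
  assumes "1 \<le> a" and "a < b" and "2 * b < M" and "gcd b M = 1"
  shows "(\<forall>L m n. ccoeff a b M L m (n * M) \<ge> 0) \<and>
         (even M \<and> odd a \<longrightarrow> (\<forall>L m n. ccoeff a b M L m (n * M + M div 2) \<ge> 0))"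
proof (intro conjI allI impI)
  \<comment> \<open>Applied with \<open>k = M\<close> and with \<open>k = M div 2\<close>; the
    congruence forces \<open>k dvd b * h\<close>, and \<open>k\<close> is coprime to
    \<open>b\<close>.\<close>
  have dvd: "k dvd h"
    if k: "k dvd M" "k dvd N" and c: "[b * h = N] (mod M) \<or> [(M - b) * h = N] (mod M)" for h k N
  proof -
    have "k dvd b * h \<or> k dvd (M - b) * h"
      using c k cong_dvd_modulus_nat cong_dvd_iff by blast
    moreover have "(M - b) * h = M * h - b * h" "b * h \<le> M * h"
      using assms by (auto simp: diff_mult_distrib)
    ultimately have "k dvd b * h"
      using k by (metis dvd_diffD1 dvd_mult2)
    moreover have "coprime k b"
      using assms(4) k(1) by (metis coprime_commute coprime_divisors coprime_iff_gcd_eq_1 dvd_refl)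
    ultimately show ?thesis by (simp add: coprime_dvd_mult_right_iff)
  qed
  fix L m n
  show "0 \<le> ccoeff a b M L m (n * M)"
    using assms dvd[of M "n * M"] by (intro ccoeff_nonneg) auto
  assume *: "even M \<and> odd a"
  then obtain K where K: "M = 2 * K" by auto
  have "odd b"
    using assms(4) * by (metis coprime_iff_gcd_eq_1 coprime_common_divisor odd_one)
  show "0 \<le> ccoeff a b M L m (n * M + M div 2)"
  proof (rule ccoeff_nonneg)
    fix h assume h: "[b * h = n * M + M div 2] (mod M) \<or> [(M - b) * h = n * M + M div 2] (mod M)"
    \<comment> \<open>Only half of \<open>M\<close> divides \<open>h\<close> for certain; the
      missing factor 2 comes from \<open>b - a\<close> and \<open>a + b\<close>, as \<open>a\<close>
      and \<open>b\<close> are odd.\<close>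
    then have "K dvd h" using dvd[of K "n * M + M div 2" h] K by simp
    moreover have "even (b - a)" "even (a + b)" using \<open>odd b\<close> * assms by auto
    ultimately show "M dvd (b - a) * h \<and> M dvd (a + b) * h"
      unfolding K by (simp add: mult_dvd_mono)
  qed (use assms in auto)
qed

end
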